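(* Let $n_1,n_2>0$, $\alpha\in(0,1)$ and $z=z_{\alpha/2}>0$. Let $(p_1,p_2)\in(0,1)^2$, $p=p_1-p_2$, and $V=V(p_1,p_2)=\frac{p_1(1-p_1)}{n_1}+\frac{p_2(1-p_2)}{n_2}>0$. Let $V^*(p)=\max\{V(q_1,q_2):(q_1,q_2)\in[0,1]^2,\ q_1-q_2=p\}$ and define $$\mathcal R(p_1,p_2)=\sqrt{\frac{V^*(p)}{V(p_1,p_2)}}\ \ge 1 .$$ If $\hat p$ is a random variable with $\hat p\sim N(p,V)$, then $$\mathbb P\bigl((p_1,p_2)\in\Gamma(\hat p)\bigr)=2\Phi\bigl(z\,\mathcal R(p_1,p_2)\bigr)-1,$$ and consequently $$\mathrm{Error}(p_1,p_2):=\mathbb P\bigl((p_1,p_2)\in\Gamma(\hat p)\bigr)-\mathbb P\bigl((p_1,p_2)\in\Omega_\square(\hat p)\bigr)=2\bigl[\Phi(z\,\mathcal R(p_1,p_2))-\Phi(z)\bigr].$$ Moreover, with $\delta(p_1,p_2)=n_2\left(p_1-\tfrac12\right)+n_1\left(p_2-\tfrac12\right)$, whenever $|p|\le\hat p_\square$ one has $$V^*(p)-V(p_1,p_2)=\frac{\delta(p_1,p_2)^2}{n_1n_2(n_1+n_2)},\qquad\text{so that}\qquad \mathcal R(p_1,p_2)^2=1+\frac{\delta(p_1,p_2)^2}{n_1n_2(n_1+n_2)V(p_1,p_2)} .$$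
   Context: $\Phi$ is the standard normal distribution function and $z=z_{\alpha/2}$ means $\Phi(z)=1-\alpha/2$. Put $\hat p_\square=\dfrac{\max(n_1,n_2)+\min(n_1,n_2)}{2\max(n_1,n_2)}$. For a real number $\hat p$ define $$\Omega_\square(\hat p)=\{(q_1,q_2)\in[0,1]^2:(\hat p-q_1+q_2)^2\le z^2V(q_1,q_2)\},$$ $$\Gamma(\hat p)=\Bigl\{(q_1,q_2)\in[0,1]^2:\ \min_{(r_1,r_2)\in\Omega_\square(\hat p)}(r_1-r_2)\le q_1-q_2\le\max_{(r_1,r_2)\in\Omega_\square(\hat p)}(r_1-r_2)\Bigr\},$$ with $\Gamma(\hat p)=\emptyset$ if $\Omega_\square(\hat p)=\emptyset$ (which can only happen for $|\hat p|>1$). The elliptically optimal (EO) confidence interval computed from $\hat p$ is $[\min_{\Omega_\square(\hat p)}(r_1-r_2),\max_{\Omega_\square(\hat p)}(r_1-r_2)]$, so $(p_1,p_2)\in\Gamma(\hat p)$ is the event that this interval covers $p$. *)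

theory Defs
  imports "HOL-Probability.Probability"
begin

definition Phi :: "real \<Rightarrow> real" where
  "Phi x = cdf std_normal_distribution x"

definition unit_square :: "(real \<times> real) set" where
  "unit_square = {0..1} \<times> {0..1}"

definition V :: "real \<Rightarrow> real \<Rightarrow> real \<Rightarrow> real \<Rightarrow> real" where
  "V n1 n2 q1 q2 = q1 * (1 - q1) / n1 + q2 * (1 - q2) / n2"

text \<open>
  The maxima and minima below range over infinite sets of reals, where \<^const>\<open>Max\<close> and
  \<^const>\<open>Min\<close> do not apply. They are written with \<^const>\<open>Greatest\<close> and \<^const>\<open>Least\<close>,
  i.e. as the greatest and least elements of these sets, so that they are meaningful only
  when attained. For positive \<open>n1\<close> and \<open>n2\<close> the sets are compact, hence the extrema are
  attained whenever the set is nonempty.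
\<close>

definition Vstar :: "real \<Rightarrow> real \<Rightarrow> real \<Rightarrow> real" where
  "Vstar n1 n2 p =
     (GREATEST v. v \<in> {V n1 n2 q1 q2 | q1 q2. (q1, q2) \<in> unit_square \<and> q1 - q2 = p})"

definition Rfactor :: "real \<Rightarrow> real \<Rightarrow> real \<Rightarrow> real \<Rightarrow> real" where
  "Rfactor n1 n2 p1 p2 = sqrt (Vstar n1 n2 (p1 - p2) / V n1 n2 p1 p2)"

definition phat_sq :: "real \<Rightarrow> real \<Rightarrow> real" where
  "phat_sq n1 n2 = (max n1 n2 + min n1 n2) / (2 * max n1 n2)"

definition delta :: "real \<Rightarrow> real \<Rightarrow> real \<Rightarrow> real \<Rightarrow> real" where
  "delta n1 n2 p1 p2 = n2 * (p1 - 1 / 2) + n1 * (p2 - 1 / 2)"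

definition Omega_sq :: "real \<Rightarrow> real \<Rightarrow> real \<Rightarrow> real \<Rightarrow> (real \<times> real) set" where
  "Omega_sq n1 n2 z ph =
     {(q1, q2) \<in> unit_square. (ph - q1 + q2)\<^sup>2 \<le> z\<^sup>2 * V n1 n2 q1 q2}"

definition eo_lower :: "real \<Rightarrow> real \<Rightarrow> real \<Rightarrow> real \<Rightarrow> real" where
  "eo_lower n1 n2 z ph = (LEAST d. d \<in> {r1 - r2 | r1 r2. (r1, r2) \<in> Omega_sq n1 n2 z ph})"

definition eo_upper :: "real \<Rightarrow> real \<Rightarrow> real \<Rightarrow> real \<Rightarrow> real" where
  "eo_upper n1 n2 z ph = (GREATEST d. d \<in> {r1 - r2 | r1 r2. (r1, r2) \<in> Omega_sq n1 n2 z ph})"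

definition Gamma_EO :: "real \<Rightarrow> real \<Rightarrow> real \<Rightarrow> real \<Rightarrow> (real \<times> real) set" where
  "Gamma_EO n1 n2 z ph =
     (if Omega_sq n1 n2 z ph = {} then {}
      else {(q1, q2) \<in> unit_square.
              eo_lower n1 n2 z ph \<le> q1 - q2 \<and> q1 - q2 \<le> eo_upper n1 n2 z ph})"

definition Error :: "'a measure \<Rightarrow> ('a \<Rightarrow> real) \<Rightarrow> real \<Rightarrow> real \<Rightarrow> real \<Rightarrow> real \<Rightarrow> real \<Rightarrow> real" where
  "Error M X n1 n2 z p1 p2 =
     measure M {\<omega> \<in> space M. (p1, p2) \<in> Gamma_EO n1 n2 z (X \<omega>)}
     - measure M {\<omega> \<in> space M. (p1, p2) \<in> Omega_sq n1 n2 z (X \<omega>)}"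

end

theory Submission
  imports Defs
begin

text \<open>
  The function \<^const>\<open>V\<close> is concave in \<open>(q1, q2)\<close> while \<open>(ph - q1 + q2)\<^sup>2\<close> is convex, so
  \<^const>\<open>Omega_sq\<close> is a compact convex set and its image under \<open>(r1, r2) \<mapsto> r1 - r2\<close> is a compact
  interval, namely \<open>[eo_lower, eo_upper]\<close> when it is nonempty. Hence the interval covers \<open>p\<close> if and only if the line
  \<open>q1 - q2 = p\<close> meets \<^const>\<open>Omega_sq\<close>. On that line the left-hand side of the defining inequality
  is the constant \<open>(ph - p)\<^sup>2\<close>, so the line meets the set exactly when the inequality holds at the
  point where \<^const>\<open>V\<close> is largest, that is, when \<open>(ph - p)\<^sup>2 \<le> z\<^sup>2 * Vstar n1 n2 p\<close>
  (\<open>mem_Gamma_EO_iff\<close>). Membership of \<open>(p1, p2)\<close> in \<^const>\<open>Omega_sq\<close> is the same inequality with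
  \<^const>\<open>V\<close> in place of \<^const>\<open>Vstar\<close>. Both coverage probabilities are thus central probabilities
  of a normal variable, which \<open>prob_normal_square_le\<close> reads off after standardization.

  For the explicit excess, \<^const>\<open>V\<close> restricted to the line is a concave parabola, whose vertex is
  given by \<open>delta n1 n2 q1 q2 = 0\<close>, and \<open>V + delta\<^sup>2 / (n1 * n2 * (n1 + n2))\<close> is constant along the
  line (\<open>V_along_difference_line\<close>). The condition \<open>\<bar>p\<bar> \<le> phat_sq n1 n2\<close> says precisely that the vertex
  belongs to the unit square, in which case the constant equals \<^const>\<open>Vstar\<close>.
\<close>

section \<open>Central probabilities of normal variables\<close>

lemma std_normal_distr_uminus: "distr std_normal_distribution borel uminus = std_normal_distribution"
proof -
  have "density (distr lborel borel uminus) std_normal_density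
      = distr (density lborel (\<lambda>x. std_normal_density (- x))) borel uminus"
    by (rule density_distr) auto
  then show ?thesis
    by (simp add: lborel_distr_uminus std_normal_density_def)
qed

text \<open>
  The complement of \<open>{-t..t}\<close> consists of two tails, which have equal mass by symmetry.
\<close>

lemma std_normal_central_prob:
  assumes "0 \<le> t"
  shows "measure std_normal_distribution {-t..t} = 2 * Phi t - 1"
proof -
  let ?N = std_normal_distribution
  interpret real_distribution ?N by (rule real_dist_normal_dist)
  have "measure ?N {..<-t} = measure (distr ?N borel uminus) {..<-t}"
    by (simp only: std_normal_distr_uminus)
  also have "\<dots> = measure ?N (uminus -` {..<-t} \<inter> space ?N)"
    by (rule measure_distr) auto
  also have "uminus -` {..<-t} \<inter> space ?N = {t<..}" by auto
  finally have tails: "measure ?N {..<-t} = measure ?N {t<..}" .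
  have "{t<..} = space ?N - {..t}" by auto
  then have upper: "measure ?N {t<..} = 1 - Phi t"
    using prob_compl[of "{..t}"] by (simp add: Phi_def cdf_def)
  have "measure ?N {..t} = measure ?N ({..<-t} \<union> {-t..t})"
    by (rule arg_cong[where f = "measure ?N"]) (use assms in auto)
  also have "\<dots> = measure ?N {..<-t} + measure ?N {-t..t}"
    by (rule finite_measure_Union) auto
  finally show ?thesis using tails upper by (simp add: Phi_def cdf_def)
qed

lemma Phi_0: "Phi 0 = 1 / 2"
proof -
  have "emeasure std_normal_distribution {0} = 0"
    by (subst emeasure_density) (auto simp: nn_integral_indicator_singleton)
  then have "measure std_normal_distribution {0} = 0" by (simp add: measure_def)
  then show ?thesis using std_normal_central_prob[of 0] by simp
qed

lemma Phi_mono: "x \<le> y \<Longrightarrow> Phi x \<le> Phi y"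
proof -
  interpret real_distribution std_normal_distribution by (rule real_dist_normal_dist)
  show "x \<le> y \<Longrightarrow> Phi x \<le> Phi y" unfolding Phi_def by (rule cdf_nondecreasing)
qed

lemma prob_normal_square_le:
  fixes p v w z :: real
  assumes "prob_space M" and dist: "distributed M lborel X (normal_density p (sqrt v))"
    and "0 < v" "0 \<le> w" "0 \<le> z"
  shows "measure M {\<omega> \<in> space M. (X \<omega> - p)\<^sup>2 \<le> z\<^sup>2 * w} = 2 * Phi (z * sqrt (w / v)) - 1"
proof -
  interpret prob_space M by fact
  define Y where "Y \<omega> = (X \<omega> - p) / sqrt v" for \<omega>
  define t where "t = z * sqrt (w / v)"
  have "0 \<le> t" using assms by (simp add: t_def)
  have Y: "distributed M lborel Y std_normal_density"
    using dist normal_standard_normal_convert[of "sqrt v" X p] \<open>0 < v\<close> by (simp add: Y_def[abs_def])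
  have meas: "Y \<in> measurable M lborel" using Y by (rule distributed_measurable)
  have "t\<^sup>2 = z\<^sup>2 * w / v" using assms by (simp add: t_def power_mult_distrib)
  have iff: "(X \<omega> - p)\<^sup>2 \<le> z\<^sup>2 * w \<longleftrightarrow> Y \<omega> \<in> {-t..t}" for \<omega>
  proof -
    have "(Y \<omega>)\<^sup>2 = (X \<omega> - p)\<^sup>2 / v" using \<open>0 < v\<close> by (simp add: Y_def power_divide)
    then have "(X \<omega> - p)\<^sup>2 \<le> z\<^sup>2 * w \<longleftrightarrow> (Y \<omega>)\<^sup>2 \<le> t\<^sup>2"
      using \<open>0 < v\<close> \<open>t\<^sup>2 = z\<^sup>2 * w / v\<close> by (simp add: divide_le_cancel)
    also have "\<dots> \<longleftrightarrow> \<bar>Y \<omega>\<bar> \<le> t"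
      using \<open>0 \<le> t\<close> by (simp flip: abs_le_square_iff)
    also have "\<dots> \<longleftrightarrow> Y \<omega> \<in> {-t..t}" by (simp add: abs_le_iff) linarith
    finally show ?thesis .
  qed
  have "{\<omega> \<in> space M. (X \<omega> - p)\<^sup>2 \<le> z\<^sup>2 * w} = Y -` {-t..t} \<inter> space M"
    unfolding iff by blast
  then have "measure M {\<omega> \<in> space M. (X \<omega> - p)\<^sup>2 \<le> z\<^sup>2 * w} = measure M (Y -` {-t..t} \<inter> space M)"
    by (rule arg_cong)
  also have "\<dots> = measure (distr M lborel Y) {-t..t}"
    by (rule measure_distr[symmetric]) (use meas in auto)
  also have "\<dots> = 2 * Phi t - 1"
    using distributed_distr_eq_density[OF Y] std_normal_central_prob[OF \<open>0 \<le> t\<close>] by simp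
  finally show ?thesis by (simp add: t_def)
qed

section \<open>Extrema over compact sets\<close>

lemma compact_Greatest:
  fixes S :: "real set"
  assumes "compact S" "S \<noteq> {}"
  shows "(GREATEST v. v \<in> S) \<in> S" and "\<And>x. x \<in> S \<Longrightarrow> x \<le> (GREATEST v. v \<in> S)"
proof -
  obtain s where s: "s \<in> S" "\<And>x. x \<in> S \<Longrightarrow> x \<le> s"
    using compact_attains_sup[OF assms] by blast
  have "(GREATEST v. v \<in> S) = s" by (rule Greatest_equality) (use s in auto)
  then show "(GREATEST v. v \<in> S) \<in> S" "\<And>x. x \<in> S \<Longrightarrow> x \<le> (GREATEST v. v \<in> S)"
    using s by auto
qed

lemma compact_Least:
  fixes S :: "real set"
  assumes "compact S" "S \<noteq> {}"
  shows "(LEAST v. v \<in> S) \<in> S" and "\<And>x. x \<in> S \<Longrightarrow> (LEAST v. v \<in> S) \<le> x"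
proof -
  obtain s where s: "s \<in> S" "\<And>x. x \<in> S \<Longrightarrow> s \<le> x"
    using compact_attains_inf[OF assms] by blast
  have "(LEAST v. v \<in> S) = s" by (rule Least_equality) (use s in auto)
  then show "(LEAST v. v \<in> S) \<in> S" "\<And>x. x \<in> S \<Longrightarrow> (LEAST v. v \<in> S) \<le> x"
    using s by auto
qed

lemma compact_unit_square: "compact unit_square"
  by (simp add: unit_square_def compact_Times)

lemma Vstar_extremal:
  assumes "n1 \<noteq> 0" "n2 \<noteq> 0" "(p1, p2) \<in> unit_square" "p = p1 - p2"
  shows Vstar_attained: "\<exists>q1 q2. (q1, q2) \<in> unit_square \<and> q1 - q2 = p \<and> V n1 n2 q1 q2 = Vstar n1 n2 p"
    and Vstar_upper: "V n1 n2 p1 p2 \<le> Vstar n1 n2 p"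
proof -
  let ?S = "{V n1 n2 q1 q2 | q1 q2. (q1, q2) \<in> unit_square \<and> q1 - q2 = p}"
  let ?L = "unit_square \<inter> {q. fst q - snd q = p}"
  have "closed {q :: real \<times> real. fst q - snd q = p}"
    by (intro closed_Collect_eq continuous_intros)
  then have "compact ?L" using compact_unit_square by (rule compact_Int_closed[rotated])
  moreover have "continuous_on ?L (\<lambda>q. V n1 n2 (fst q) (snd q))"
    unfolding V_def by (intro continuous_intros) (use assms in auto)
  ultimately have "compact ((\<lambda>q. V n1 n2 (fst q) (snd q)) ` ?L)"
    by (intro compact_continuous_image)
  moreover have eq: "?S = (\<lambda>q. V n1 n2 (fst q) (snd q)) ` ?L" by force
  ultimately have compact: "compact ?S" by simp
  have mem: "V n1 n2 p1 p2 \<in> ?S" using assms by blast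
  then have "?S \<noteq> {}" by blast
  note extremal = compact_Greatest[OF compact this, folded Vstar_def]
  show "V n1 n2 p1 p2 \<le> Vstar n1 n2 p" using extremal(2)[OF mem] .
  show "\<exists>q1 q2. (q1, q2) \<in> unit_square \<and> q1 - q2 = p \<and> V n1 n2 q1 q2 = Vstar n1 n2 p"
    using extremal(1) by force
qed

section \<open>The covering event\<close>

lemma compact_Omega_sq:
  assumes "n1 \<noteq> 0" "n2 \<noteq> 0"
  shows "compact (Omega_sq n1 n2 z ph)"
proof -
  have "Omega_sq n1 n2 z ph = unit_square \<inter>
      {q. (ph - fst q + snd q)\<^sup>2 \<le> z\<^sup>2 * V n1 n2 (fst q) (snd q)}"
    by (auto simp: Omega_sq_def)
  moreover have "closed {q. (ph - fst q + snd q)\<^sup>2 \<le> z\<^sup>2 * V n1 n2 (fst q) (snd q)}"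
    unfolding V_def by (intro closed_Collect_le continuous_intros) (use assms in auto)
  ultimately show ?thesis using compact_unit_square by (simp add: compact_Int_closed)
qed

text \<open>
  The gap is explicitly \<open>u * v * ((r1 - s1)\<^sup>2 / n1 + (r2 - s2)\<^sup>2 / n2)\<close>: each summand of
  \<^const>\<open>V\<close> is a parabola with leading coefficient \<open>- 1 / n1\<close> or \<open>- 1 / n2\<close>.
\<close>

lemma V_concave:
  assumes "0 < n1" "0 < n2" "0 \<le> u" "0 \<le> v" "u + v = 1"
  shows "u * V n1 n2 r1 r2 + v * V n1 n2 s1 s2 \<le> V n1 n2 (u * r1 + v * s1) (u * r2 + v * s2)"
proof -
  have v: "v = 1 - u" using assms by simp
  have "V n1 n2 (u * r1 + v * s1) (u * r2 + v * s2) - (u * V n1 n2 r1 r2 + v * V n1 n2 s1 s2)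
      = u * v * ((r1 - s1)\<^sup>2 / n1 + (r2 - s2)\<^sup>2 / n2)"
    using assms(1,2) unfolding V_def v by (simp add: divide_simps power2_eq_square) algebra
  also have "\<dots> \<ge> 0" using assms by simp
  finally show ?thesis by simp
qed

lemma convex_Omega_sq:
  assumes "0 < n1" "0 < n2"
  shows "convex (Omega_sq n1 n2 z ph)"
proof (rule convexI)
  fix r s :: "real \<times> real" and u v :: real
  assume r: "r \<in> Omega_sq n1 n2 z ph" and s: "s \<in> Omega_sq n1 n2 z ph"
    and uv: "0 \<le> u" "0 \<le> v" "u + v = 1"
  obtain r1 r2 s1 s2 where rs: "r = (r1, r2)" "s = (s1, s2)" by (cases r, cases s)
  have "convex unit_square" by (simp add: unit_square_def convex_Times)
  then have square: "u *\<^sub>R r + v *\<^sub>R s \<in> unit_square"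
    using r s uv by (auto simp: Omega_sq_def intro: convexD)
  let ?a = "ph - r1 + r2" and ?b = "ph - s1 + s2"
  have a: "?a\<^sup>2 \<le> z\<^sup>2 * V n1 n2 r1 r2" and b: "?b\<^sup>2 \<le> z\<^sup>2 * V n1 n2 s1 s2"
    using r s by (auto simp: Omega_sq_def rs)
  have v: "v = 1 - u" using uv by simp
  have "(ph - (u * r1 + v * s1) + (u * r2 + v * s2))\<^sup>2 = u * ?a\<^sup>2 + v * ?b\<^sup>2 - u * v * (?a - ?b)\<^sup>2"
    unfolding v by algebra
  also have "\<dots> \<le> u * ?a\<^sup>2 + v * ?b\<^sup>2" using uv by simp
  also have "\<dots> \<le> u * (z\<^sup>2 * V n1 n2 r1 r2) + v * (z\<^sup>2 * V n1 n2 s1 s2)"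
    using a b uv by (intro add_mono mult_left_mono)
  also have "\<dots> = z\<^sup>2 * (u * V n1 n2 r1 r2 + v * V n1 n2 s1 s2)" by algebra
  also have "\<dots> \<le> z\<^sup>2 * V n1 n2 (u * r1 + v * s1) (u * r2 + v * s2)"
    using V_concave[OF assms uv] by (intro mult_left_mono) auto
  finally show "u *\<^sub>R r + v *\<^sub>R s \<in> Omega_sq n1 n2 z ph"
    using square by (simp add: Omega_sq_def rs)
qed

text \<open>
  A compact convex set of differences is an interval, so lying between its extreme values is the
  same as being a difference.
\<close>

lemma mem_Gamma_EO_iff_difference:
  assumes "0 < n1" "0 < n2" "(p1, p2) \<in> unit_square"
  shows "(p1, p2) \<in> Gamma_EO n1 n2 z ph \<longleftrightarrow>
    p1 - p2 \<in> {r1 - r2 | r1 r2. (r1, r2) \<in> Omega_sq n1 n2 z ph}"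
proof (cases "Omega_sq n1 n2 z ph = {}")
  case True
  then show ?thesis by (simp add: Gamma_EO_def)
next
  case False
  let ?D = "{r1 - r2 | r1 r2. (r1, r2) \<in> Omega_sq n1 n2 z ph}"
  have eq: "?D = (\<lambda>r. fst r - snd r) ` Omega_sq n1 n2 z ph" by force
  have compact: "compact ?D" unfolding eq
    by (intro compact_continuous_image continuous_intros compact_Omega_sq) (use assms in auto)
  have "linear (\<lambda>r :: real \<times> real. fst r - snd r)"
    by (intro linearI) (auto simp: algebra_simps)
  then have "convex ?D" unfolding eq
    using convex_Omega_sq[OF assms(1,2)] by (rule convex_linear_image)
  then have interval: "is_interval ?D" by (simp add: is_interval_convex_1)
  have "?D \<noteq> {}" using False unfolding eq by simp
  note lower = compact_Least[OF compact this, folded eo_lower_def]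
    and upper = compact_Greatest[OF compact this, folded eo_upper_def]
  have "eo_lower n1 n2 z ph \<le> d \<and> d \<le> eo_upper n1 n2 z ph \<longleftrightarrow> d \<in> ?D" for d
    using mem_is_interval_1_I[OF interval lower(1) upper(1)] lower(2) upper(2) by blast
  from this[of "p1 - p2"] show ?thesis
    using False assms(3) by (simp add: Gamma_EO_def)
qed

text \<open>
  On the line \<open>q1 - q2 = p\<close> the quantity \<open>(ph - q1 + q2)\<^sup>2\<close> is constant, so the line contains a
  point of \<^const>\<open>Omega_sq\<close> if and only if its point of largest variance is one.
\<close>

lemma mem_Gamma_EO_iff:
  assumes "0 < n1" "0 < n2" "(p1, p2) \<in> unit_square" "p = p1 - p2"
  shows "(p1, p2) \<in> Gamma_EO n1 n2 z ph \<longleftrightarrow> (ph - p)\<^sup>2 \<le> z\<^sup>2 * Vstar n1 n2 p"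
proof
  assume "(p1, p2) \<in> Gamma_EO n1 n2 z ph"
  then obtain r1 r2 where r: "(r1, r2) \<in> Omega_sq n1 n2 z ph" "r1 - r2 = p"
    using assms by (auto simp: mem_Gamma_EO_iff_difference)
  then have "ph - r1 + r2 = ph - p" by simp
  with r have "(ph - p)\<^sup>2 \<le> z\<^sup>2 * V n1 n2 r1 r2" by (simp add: Omega_sq_def)
  also have "\<dots> \<le> z\<^sup>2 * Vstar n1 n2 p"
    using r assms by (intro mult_left_mono Vstar_upper) (auto simp: Omega_sq_def)
  finally show "(ph - p)\<^sup>2 \<le> z\<^sup>2 * Vstar n1 n2 p" .
next
  assume le: "(ph - p)\<^sup>2 \<le> z\<^sup>2 * Vstar n1 n2 p"
  obtain q1 q2 where q: "(q1, q2) \<in> unit_square" "q1 - q2 = p" "V n1 n2 q1 q2 = Vstar n1 n2 p"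
    using Vstar_attained[of n1 n2 p1 p2 p] assms by auto
  have diff: "ph - q1 + q2 = ph - p" using q(2) by simp
  have "(q1, q2) \<in> Omega_sq n1 n2 z ph"
    unfolding Omega_sq_def using le q(1,3) by (simp add: diff)
  then have "p \<in> {r1 - r2 | r1 r2. (r1, r2) \<in> Omega_sq n1 n2 z ph}" using q(2) by blast
  then show "(p1, p2) \<in> Gamma_EO n1 n2 z ph"
    unfolding mem_Gamma_EO_iff_difference[OF assms(1-3)] assms(4) .
qed

section \<open>The maximal variance on a line of constant difference\<close>

text \<open>
  Moving along \<open>(1, 1)\<close> by \<open>t\<close> changes \<^const>\<open>delta\<close> by \<open>(n1 + n2) * t\<close>, while the second-order
  term of \<^const>\<open>V\<close> is \<open>- (1 / n1 + 1 / n2) * t\<^sup>2\<close>; the denominator is chosen so that these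
  quadratic terms cancel. The linear terms cancel as well, because \<^const>\<open>V\<close> is
  stationary in the direction \<open>(1, 1)\<close> wherever \<^const>\<open>delta\<close> vanishes.
\<close>

lemma V_along_difference_line:
  assumes "0 < n1" "0 < n2" "q1 - q2 = p1 - p2"
  shows "V n1 n2 p1 p2 + (delta n1 n2 p1 p2)\<^sup>2 / (n1 * n2 * (n1 + n2))
    = V n1 n2 q1 q2 + (delta n1 n2 q1 q2)\<^sup>2 / (n1 * n2 * (n1 + n2))"
proof -
  have q1: "q1 = q2 + p1 - p2" using assms by simp
  have "n1 + n2 \<noteq> 0" using assms by simp
  then show ?thesis
    using assms(1,2) unfolding V_def delta_def q1
    by (simp add: divide_simps power2_eq_square) algebra
qed

text \<open>
  On the line, \<^const>\<open>V\<close> has its vertex at coordinates of distance \<open>n1 * \<bar>p\<bar> / (n1 + n2)\<close> and \<open>n2 * \<bar>p\<bar> / (n1 + n2)\<close> from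
  \<open>1 / 2\<close>. The larger of these is at most \<open>1 / 2\<close> exactly when \<open>\<bar>p\<bar> \<le> phat_sq n1 n2\<close>, so the
  vertex is then an admissible maximizer.
\<close>

lemma Vstar_diff_V:
  assumes "0 < n1" "0 < n2" "(p1, p2) \<in> unit_square" "p = p1 - p2" "\<bar>p\<bar> \<le> phat_sq n1 n2"
  shows "Vstar n1 n2 p - V n1 n2 p1 p2 = (delta n1 n2 p1 p2)\<^sup>2 / (n1 * n2 * (n1 + n2))"
proof -
  let ?c = "n1 * n2 * (n1 + n2)"
  have c: "0 < ?c" using assms by simp
  \<comment> \<open>The vertex of the parabola: the solution of \<open>delta n1 n2 m1 m2 = 0\<close> and \<open>m1 - m2 = p\<close>.\<close>
  define m1 where "m1 = 1 / 2 + n1 * p / (n1 + n2)"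
  define m2 where "m2 = 1 / 2 - n2 * p / (n1 + n2)"
  have bound: "\<bar>n * p / (n1 + n2)\<bar> \<le> 1 / 2" if "0 < n" "n \<le> max n1 n2" for n
  proof -
    have "n * \<bar>p\<bar> \<le> max n1 n2 * \<bar>p\<bar>" using that by (intro mult_right_mono) auto
    also have "\<dots> \<le> max n1 n2 * phat_sq n1 n2"
      using assms by (intro mult_left_mono) auto
    also have "\<dots> = (n1 + n2) / 2" using assms by (simp add: phat_sq_def max_def min_def)
    finally have "n * \<bar>p\<bar> \<le> (n1 + n2) / 2" .
    then show ?thesis using assms(1,2) that(1) by (simp add: abs_mult field_simps)
  qed
  have "\<bar>n1 * p / (n1 + n2)\<bar> \<le> 1 / 2" "\<bar>n2 * p / (n1 + n2)\<bar> \<le> 1 / 2"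
    using bound[of n1] bound[of n2] assms(1,2) by auto
  then have m_square: "(m1, m2) \<in> unit_square"
    unfolding unit_square_def m1_def m2_def mem_Times_iff atLeastAtMost_iff fst_conv snd_conv
      abs_le_iff by linarith
  have "m1 - m2 = (n1 + n2) * p / (n1 + n2)"
    by (simp add: m1_def m2_def ring_distribs add_divide_distrib)
  then have m_diff: "m1 - m2 = p" using assms by simp
  have m_delta: "delta n1 n2 m1 m2 = 0" by (simp add: delta_def m1_def m2_def)
  obtain q1 q2 where q: "(q1, q2) \<in> unit_square" "q1 - q2 = p" "V n1 n2 q1 q2 = Vstar n1 n2 p"
    using Vstar_attained[of n1 n2 p1 p2 p] assms by auto
  have "Vstar n1 n2 p + (delta n1 n2 q1 q2)\<^sup>2 / ?c = V n1 n2 m1 m2"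
    using V_along_difference_line[of n1 n2 m1 m2 q1 q2] assms q m_diff m_delta by simp
  moreover have "0 \<le> (delta n1 n2 q1 q2)\<^sup>2 / ?c" using c by simp
  moreover have "V n1 n2 m1 m2 \<le> Vstar n1 n2 p"
    using assms m_square m_diff by (intro Vstar_upper) auto
  ultimately have "Vstar n1 n2 p = V n1 n2 m1 m2" by linarith
  moreover have "V n1 n2 p1 p2 + (delta n1 n2 p1 p2)\<^sup>2 / ?c = V n1 n2 m1 m2"
    using V_along_difference_line[of n1 n2 m1 m2 p1 p2] assms m_diff m_delta by simp
  ultimately show ?thesis by linarith
qed

section \<open>Coverage probability and error\<close>

theorem theorem2:
  fixes n1 n2 \<alpha> z p1 p2 p :: real and M :: "'a measure" and X :: "'a \<Rightarrow> real"
  assumes "n1 > 0" and "n2 > 0"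
    and "0 < \<alpha>" and "\<alpha> < 1"
    and "Phi z = 1 - \<alpha> / 2"
    and "p1 \<in> {0<..<1}" and "p2 \<in> {0<..<1}"
    and "p = p1 - p2"
    and "prob_space M"
    and "distributed M lborel X (normal_density p (sqrt (V n1 n2 p1 p2)))"
  shows "z > 0 \<and> V n1 n2 p1 p2 > 0 \<and> Rfactor n1 n2 p1 p2 \<ge> 1
    \<and> measure M {\<omega> \<in> space M. (p1, p2) \<in> Gamma_EO n1 n2 z (X \<omega>)}
        = 2 * Phi (z * Rfactor n1 n2 p1 p2) - 1
    \<and> Error M X n1 n2 z p1 p2 = 2 * (Phi (z * Rfactor n1 n2 p1 p2) - Phi z)
    \<and> (\<bar>p\<bar> \<le> phat_sq n1 n2 \<longrightarrow>
         Vstar n1 n2 p - V n1 n2 p1 p2 = (delta n1 n2 p1 p2)\<^sup>2 / (n1 * n2 * (n1 + n2))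
         \<and> (Rfactor n1 n2 p1 p2)\<^sup>2
             = 1 + (delta n1 n2 p1 p2)\<^sup>2 / (n1 * n2 * (n1 + n2) * V n1 n2 p1 p2))"
proof -
  let ?V = "V n1 n2 p1 p2" and ?W = "Vstar n1 n2 p" and ?R = "Rfactor n1 n2 p1 p2"
  have square: "(p1, p2) \<in> unit_square" using assms by (simp add: unit_square_def)
  have "Phi 0 < Phi z" using assms by (simp add: Phi_0)
  then have z: "0 < z" using Phi_mono[of z 0] by force
  have V: "0 < ?V" using assms by (simp add: V_def add_pos_pos)
  have VW: "?V \<le> ?W" using Vstar_upper[of n1 n2 p1 p2 p] assms square by simp
  have R: "?R = sqrt (?W / ?V)" using assms by (simp add: Rfactor_def)
  have R1: "1 \<le> ?R" using V VW by (simp add: R)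
  have R2: "?R\<^sup>2 = ?W / ?V" using V VW by (simp add: R)
  note prob = prob_normal_square_le[OF assms(9,10) V]
  have gamma: "measure M {\<omega> \<in> space M. (p1, p2) \<in> Gamma_EO n1 n2 z (X \<omega>)} = 2 * Phi (z * ?R) - 1"
    using prob[of ?W z] V VW z mem_Gamma_EO_iff[OF assms(1,2) square assms(8)] by (simp add: R)
  have "(p1, p2) \<in> Omega_sq n1 n2 z ph \<longleftrightarrow> (ph - p)\<^sup>2 \<le> z\<^sup>2 * ?V" for ph
  proof -
    have "ph - p1 + p2 = ph - p" using assms(8) by simp
    from square show ?thesis by (simp add: Omega_sq_def \<open>ph - p1 + p2 = ph - p\<close>)
  qed
  then have omega: "measure M {\<omega> \<in> space M. (p1, p2) \<in> Omega_sq n1 n2 z (X \<omega>)} = 2 * Phi z - 1"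
    using prob[of ?V z] V z by simp
  have excess: "?W - ?V = (delta n1 n2 p1 p2)\<^sup>2 / (n1 * n2 * (n1 + n2))" if "\<bar>p\<bar> \<le> phat_sq n1 n2"
    using Vstar_diff_V[OF assms(1,2) square assms(8) that] .
  have "?R\<^sup>2 = 1 + (?W - ?V) / ?V" using V by (simp add: R2 field_simps)
  with excess have "?R\<^sup>2 = 1 + (delta n1 n2 p1 p2)\<^sup>2 / (n1 * n2 * (n1 + n2) * ?V)"
    if "\<bar>p\<bar> \<le> phat_sq n1 n2"
    using that by simp
  with z V R1 gamma omega excess show ?thesis by (simp add: Error_def)
qed

end
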